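(* Suppose that the initial boundary value problem (IBVP) for network flow described in the context satisfies assumptions (i)–(iv) listed there, and that for all $(i,j)\in\mathcal{E}$ the dissipation function $f_{ij}(t,u,v)$ is strictly increasing in the third argument $v$. Let $\rho_{ij}^{(1)}(0,x_{ij})$ and $\rho_{ij}^{(2)}(0,x_{ij})$ be two initial conditions satisfying $\rho_{ij}^{(1)}(0,x_{ij})\ge\rho_{ij}^{(2)}(0,x_{ij})$ for all $(i,j)\in\mathcal{E}$ and $x_{ij}\in I_{ij}$, and let $\rho^{(1)},\rho^{(2)}$ be the densities of the corresponding solutions of the IBVP with injections $q^{(1)}$ and $q^{(2)}$ respectively. Let $\mathcal{S}\subseteq\mathcal{V}$ be an arbitrary subset of $\mathcal{V}$. Let $t_0\in[0,T]$ and suppose that $q_i^{(1)}(t)\ge q_i^{(2)}(t)$ for all $i\in\mathcal{S}$ and $t\in[0,t_0]$, and that $\rho_i^{(1)}(t)\ge\rho_i^{(2)}(t)$ for all $i\in\mathcal{V}\setminus\mathcal{S}$ and $t\in[0,t_0]$. Then $\rho_{ij}^{(1)}(t,x_{ij})\ge\rho_{ij}^{(2)}(t,x_{ij})$ for all $(i,j)\in\mathcal{E}$, $x_{ij}\in I_{ij}$ and $t\in[0,t_0]$.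
   Context: Let $(\mathcal{V},\mathcal{E},\lambda)$ be a finite metric graph with directed edges $\mathcal{E}\subset\mathcal{V}\times\mathcal{V}$, lengths $L_{ij}=\lambda(i,j)>0$, $I_{ij}=[0,L_{ij}]$, $\partial_+j=\{i:(i,j)\in\mathcal{E}\}$, $\partial_-j=\{k:(j,k)\in\mathcal{E}\}$. $\mathbb{R}_+$ denotes the non-negative reals. On each edge there are a flow $\phi_{ij}:[0,T]\times I_{ij}\to\mathbb{R}$ and a density $\rho_{ij}:[0,T]\times I_{ij}\to\mathbb{R}_+$; each vertex $i$ has an internal nodal density $\rho_i:[0,T]\to\mathbb{R}_+$ and an injection $q_i:[0,T]\to\mathbb{R}$. Write $\underline{\rho}_{ij}(t)=\rho_{ij}(t,0)$, $\overline{\rho}_{ij}(t)=\rho_{ij}(t,L_{ij})$, $\underline{\phi}_{ij}(t)=\phi_{ij}(t,0)$, $\overline{\phi}_{ij}(t)=\phi_{ij}(t,L_{ij})$. The IBVP consists of, for all $(i,j)\in\mathcal{E}$ and $j\in\mathcal{V}$, $$\partial_t\rho_{ij}(t,x)+\partial_x\phi_{ij}(t,x)=0,\qquad \phi_{ij}(t,x)+f_{ij}(t,\rho_{ij}(t,x),\partial_x\rho_{ij}(t,x))=0,$$ $$q_j(t)+\sum_{i\in\partial_+j}\overline{\phi}_{ij}(t)-\sum_{k\in\partial_-j}\underline{\phi}_{jk}(t)=0,$$ $$\underline{\rho}_{ij}(t)=\underline{\alpha}_{ij}(t,\rho_i(t)),\qquad \overline{\rho}_{ij}(t)=\overline{\alpha}_{ij}(t,\rho_j(t)),$$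 $$\rho_{ij}(0,x)=\rho_{ij}^0(x),\qquad \phi_{ij}(0,x)=\phi_{ij}^0(x),$$ where $f_{ij}:[0,T]\times\mathbb{R}_+\times\mathbb{R}\to\mathbb{R}$ are given dissipation functions and the compatibility functions $\underline{\alpha}_{ij}(t,\rho),\overline{\alpha}_{ij}(t,\rho)$ are strictly increasing in $\rho>0$ for each $t\in[0,T]$. The functions $f_{ij},\underline{\alpha}_{ij},\overline{\alpha}_{ij}$ are the same in the two scenarios. Assumptions: (i) $\rho_{ij}^0,\phi_{ij}^0\in C^2([0,L_{ij}])$ for all edges, and the flow balance and density compatibility conditions at the vertices hold at $t=0$. (ii) $\underline{\alpha}_{ij},\overline{\alpha}_{ij}\in C^2_+([0,T]\times\mathbb{R}_+)$ (twice continuously differentiable, non-negative valued) for all edges and $q_i\in C^2([0,T])$ for all vertices. (iii) The IBVP admits a unique classical solution that is twice continuously differentiable. (iv) Stability under small perturbations: let $(\rho_{ij},\phi_{ij})$ be the unique classical solution of the IBVP and let $(\rho_{ij,\epsilon},\phi_{ij,\epsilon})$ be a solution of the perturbed system $$\partial_t\rho_{ij,\epsilon}+\partial_x\phi_{ij,\epsilon}-\epsilon=0,\qquad \phi_{ij,\epsilon}+f_{ij}(t,\rho_{ij,\epsilon},\partial_x\rho_{ij,\epsilon})=0,$$ (with the same vertex conditions) with initial conditions $\rho_{ij,\epsilon}(0,x)=\rho_{ij}^0(x)+\epsilon$, $\phi_{ij,\epsilon}(0,x)=\phi_{ij}^0(x)$. Then $\lim_{\epsilon\to0}\rho_{ij,\epsilon}(t,x_{ij})=\rho_{ij}(t,x_{ij})$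 for all $(i,j)\in\mathcal{E}$, $x_{ij}\in I_{ij}$, $t\in[0,T]$. *)

theory Defs
  imports "HOL-Analysis.Analysis"
begin

text \<open>
  Continuous differentiability on a set that need not be open: all derivatives are taken within
  the set. On the closed rectangles and half-strips used below, this is the usual differentiability
  up to the boundary (one-sided derivatives at boundary points).
\<close>

definition C1_on :: "('a::real_normed_vector \<Rightarrow> 'b::real_normed_vector) \<Rightarrow> 'a set \<Rightarrow> bool" where
  "C1_on g S \<longleftrightarrow>
     (\<exists>g' :: 'a \<Rightarrow> 'a \<Rightarrow>\<^sub>L 'b.
        (\<forall>x\<in>S. (g has_derivative blinfun_apply (g' x)) (at x within S)) \<and> continuous_on S g')"

definition C2_on :: "('a::real_normed_vector \<Rightarrow> 'b::real_normed_vector) \<Rightarrow> 'a set \<Rightarrow> bool" where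
  "C2_on g S \<longleftrightarrow>
     (\<exists>g' :: 'a \<Rightarrow> 'a \<Rightarrow>\<^sub>L 'b.
        (\<forall>x\<in>S. (g has_derivative blinfun_apply (g' x)) (at x within S)) \<and> C1_on g' S)"

text \<open>
  A metric graph with the time horizon \<open>T\<close>, the dissipation functions \<open>f i j t u v\<close> and
  the compatibility functions \<open>\<alpha> i j t \<rho>\<close> at the tail (\<open>alpha_lo\<close>) and at
  the head (\<open>alpha_hi\<close>) of the edge \<open>(i, j)\<close>. Only the values at edges, at times in
  \<open>[0, T]\<close> and at non-negative densities are ever used.
\<close>

record 'v flow_network =
  vertices :: "'v set"
  edges :: "('v \<times> 'v) set"
  edge_len :: "'v \<Rightarrow> 'v \<Rightarrow> real"
  horizon :: real
  dissip :: "'v \<Rightarrow> 'v \<Rightarrow> real \<Rightarrow> real \<Rightarrow> real \<Rightarrow> real"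
  alpha_lo :: "'v \<Rightarrow> 'v \<Rightarrow> real \<Rightarrow> real \<Rightarrow> real"
  alpha_hi :: "'v \<Rightarrow> 'v \<Rightarrow> real \<Rightarrow> real \<Rightarrow> real"

type_synonym 'v edge_data = "'v \<Rightarrow> 'v \<Rightarrow> real \<Rightarrow> real"           \<comment> \<open>\<open>i j x\<close>\<close>
type_synonym 'v edge_field = "'v \<Rightarrow> 'v \<Rightarrow> real \<Rightarrow> real \<Rightarrow> real"  \<comment> \<open>\<open>i j t x\<close>\<close>
type_synonym 'v node_field = "'v \<Rightarrow> real \<Rightarrow> real"               \<comment> \<open>\<open>i t\<close>\<close>

definition flow_network :: "'v flow_network \<Rightarrow> bool" where
  "flow_network N \<longleftrightarrow>
     finite (vertices N) \<and> edges N \<subseteq> vertices N \<times> vertices N \<and>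
     (\<forall>(i, j)\<in>edges N. 0 < edge_len N i j) \<and>
     (\<forall>(i, j)\<in>edges N. \<forall>t\<in>{0..horizon N}.
        strict_mono_on {0<..} (alpha_lo N i j t) \<and> strict_mono_on {0<..} (alpha_hi N i j t))"

definition dissipation_strict_mono :: "'v flow_network \<Rightarrow> bool" where
  "dissipation_strict_mono N \<longleftrightarrow>
     (\<forall>(i, j)\<in>edges N. \<forall>t\<in>{0..horizon N}. \<forall>u\<ge>0. strict_mono (dissip N i j t u))"

definition partial_t :: "real \<Rightarrow> (real \<Rightarrow> real \<Rightarrow> real) \<Rightarrow> real \<Rightarrow> real \<Rightarrow> real" where
  "partial_t T u t x = vector_derivative (\<lambda>s. u s x) (at t within {0..T})"

definition partial_x :: "real \<Rightarrow> (real \<Rightarrow> real \<Rightarrow> real) \<Rightarrow> real \<Rightarrow> real \<Rightarrow> real" where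
  "partial_x L u t x = vector_derivative (\<lambda>y. u t y) (at x within {0..L})"

text \<open>\<open>phi_hi\<close> and \<open>phi_lo\<close> are the edge flows at the head and at the tail of each edge.\<close>

definition flow_balance_at ::
    "'v flow_network \<Rightarrow> ('v \<Rightarrow> real) \<Rightarrow> ('v \<Rightarrow> 'v \<Rightarrow> real) \<Rightarrow> ('v \<Rightarrow> 'v \<Rightarrow> real) \<Rightarrow> bool" where
  "flow_balance_at N q phi_lo phi_hi \<longleftrightarrow>
     (\<forall>j\<in>vertices N.
        q j + (\<Sum>i\<in>{i. (i, j) \<in> edges N}. phi_hi i j) - (\<Sum>k\<in>{k. (j, k) \<in> edges N}. phi_lo j k) = 0)"

definition density_compat_at ::
    "'v flow_network \<Rightarrow> real \<Rightarrow> ('v \<Rightarrow> real) \<Rightarrow> ('v \<Rightarrow> 'v \<Rightarrow> real) \<Rightarrow> ('v \<Rightarrow> 'v \<Rightarrow> real) \<Rightarrow> bool" where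
  "density_compat_at N t r rho_lo rho_hi \<longleftrightarrow>
     (\<forall>(i, j)\<in>edges N.
        rho_lo i j = alpha_lo N i j t (r i) \<and> rho_hi i j = alpha_hi N i j t (r j))"

text \<open>
  A classical (twice continuously differentiable) solution of the perturbed system: \<open>\<rho>\<close> and
  \<open>\<phi>\<close> are the edge densities and flows, \<open>r\<close> the internal nodal densities. The
  perturbation \<open>\<epsilon>\<close> enters both the mass balance and the initial density.
\<close>

definition perturbed_solution ::
    "'v flow_network \<Rightarrow> real \<Rightarrow> 'v edge_data \<Rightarrow> 'v edge_data \<Rightarrow> 'v node_field \<Rightarrow>
     'v edge_field \<Rightarrow> 'v edge_field \<Rightarrow> 'v node_field \<Rightarrow> bool" where
  "perturbed_solution N \<epsilon> \<rho>0 \<phi>0 q \<rho> \<phi> r \<longleftrightarrow>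
     (\<forall>(i, j)\<in>edges N.
        C2_on (\<lambda>(t, x). \<rho> i j t x) ({0..horizon N} \<times> {0..edge_len N i j}) \<and>
        C2_on (\<lambda>(t, x). \<phi> i j t x) ({0..horizon N} \<times> {0..edge_len N i j}) \<and>
        (\<forall>t\<in>{0..horizon N}. \<forall>x\<in>{0..edge_len N i j}.
           \<rho> i j t x \<ge> 0 \<and>
           partial_t (horizon N) (\<rho> i j) t x + partial_x (edge_len N i j) (\<phi> i j) t x - \<epsilon> = 0 \<and>
           \<phi> i j t x + dissip N i j t (\<rho> i j t x) (partial_x (edge_len N i j) (\<rho> i j) t x) = 0) \<and>
        (\<forall>x\<in>{0..edge_len N i j}. \<rho> i j 0 x = \<rho>0 i j x + \<epsilon> \<and> \<phi> i j 0 x = \<phi>0 i j x)) \<and>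
     (\<forall>t\<in>{0..horizon N}.
        (\<forall>i\<in>vertices N. r i t \<ge> 0) \<and>
        flow_balance_at N (\<lambda>j. q j t)
          (\<lambda>i j. \<phi> i j t 0) (\<lambda>i j. \<phi> i j t (edge_len N i j)) \<and>
        density_compat_at N t (\<lambda>i. r i t)
          (\<lambda>i j. \<rho> i j t 0) (\<lambda>i j. \<rho> i j t (edge_len N i j)))"

definition ibvp_solution ::
    "'v flow_network \<Rightarrow> 'v edge_data \<Rightarrow> 'v edge_data \<Rightarrow> 'v node_field \<Rightarrow>
     'v edge_field \<Rightarrow> 'v edge_field \<Rightarrow> 'v node_field \<Rightarrow> bool" where
  "ibvp_solution N \<rho>0 \<phi>0 q \<rho> \<phi> r \<longleftrightarrow> perturbed_solution N 0 \<rho>0 \<phi>0 q \<rho> \<phi> r"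

definition regular_initial_data ::
    "'v flow_network \<Rightarrow> 'v edge_data \<Rightarrow> 'v edge_data \<Rightarrow> 'v node_field \<Rightarrow> bool" where
  "regular_initial_data N \<rho>0 \<phi>0 q \<longleftrightarrow>
     (\<forall>(i, j)\<in>edges N. C2_on (\<rho>0 i j) {0..edge_len N i j} \<and> C2_on (\<phi>0 i j) {0..edge_len N i j}) \<and>
     flow_balance_at N (\<lambda>j. q j 0) (\<lambda>i j. \<phi>0 i j 0) (\<lambda>i j. \<phi>0 i j (edge_len N i j)) \<and>
     (\<exists>r0. (\<forall>i\<in>vertices N. r0 i \<ge> 0) \<and>
           density_compat_at N 0 r0 (\<lambda>i j. \<rho>0 i j 0) (\<lambda>i j. \<rho>0 i j (edge_len N i j)))"

definition regular_compatibility :: "'v flow_network \<Rightarrow> bool" where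
  "regular_compatibility N \<longleftrightarrow>
     (\<forall>(i, j)\<in>edges N. \<forall>a\<in>{alpha_lo N i j, alpha_hi N i j}.
        C2_on (\<lambda>(t, \<rho>). a t \<rho>) ({0..horizon N} \<times> {0..}) \<and>
        (\<forall>t\<in>{0..horizon N}. \<forall>\<rho>\<ge>0. a t \<rho> \<ge> 0))"

definition regular_injections :: "'v flow_network \<Rightarrow> 'v node_field \<Rightarrow> bool" where
  "regular_injections N q \<longleftrightarrow> (\<forall>i\<in>vertices N. C2_on (q i) {0..horizon N})"

text \<open>
  Uniqueness is that of the edge densities and flows; the internal density of an isolated vertex is
  not constrained by the system.
\<close>

definition unique_ibvp_solution ::
    "'v flow_network \<Rightarrow> 'v edge_data \<Rightarrow> 'v edge_data \<Rightarrow> 'v node_field \<Rightarrow> bool" where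
  "unique_ibvp_solution N \<rho>0 \<phi>0 q \<longleftrightarrow>
     (\<exists>\<rho> \<phi> r. ibvp_solution N \<rho>0 \<phi>0 q \<rho> \<phi> r \<and>
        (\<forall>\<rho>' \<phi>' r'. ibvp_solution N \<rho>0 \<phi>0 q \<rho>' \<phi>' r' \<longrightarrow>
           (\<forall>(i, j)\<in>edges N. \<forall>t\<in>{0..horizon N}. \<forall>x\<in>{0..edge_len N i j}.
              \<rho>' i j t x = \<rho> i j t x \<and> \<phi>' i j t x = \<phi> i j t x)))"

text \<open>
  \<open>A\<close> is the set of perturbations for which a perturbed solution is given. Existence of
  perturbed solutions is not part of the condition.
\<close>

definition perturbation_stable ::
    "'v flow_network \<Rightarrow> 'v edge_data \<Rightarrow> 'v edge_data \<Rightarrow> 'v node_field \<Rightarrow> bool" where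
  "perturbation_stable N \<rho>0 \<phi>0 q \<longleftrightarrow>
     (\<forall>\<rho> \<phi> r A \<rho>\<epsilon> \<phi>\<epsilon> r\<epsilon>.
        ibvp_solution N \<rho>0 \<phi>0 q \<rho> \<phi> r \<longrightarrow>
        (\<forall>\<epsilon>\<in>A. perturbed_solution N \<epsilon> \<rho>0 \<phi>0 q (\<rho>\<epsilon> \<epsilon>) (\<phi>\<epsilon> \<epsilon>) (r\<epsilon> \<epsilon>)) \<longrightarrow>
        (\<forall>(i, j)\<in>edges N. \<forall>x\<in>{0..edge_len N i j}. \<forall>t\<in>{0..horizon N}.
           ((\<lambda>\<epsilon>. \<rho>\<epsilon> \<epsilon> i j t x) \<longlongrightarrow> \<rho> i j t x) (at 0 within A)))"

end

theory Submission
  imports Defs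
begin

text \<open>
  The comparison is an \<open>L\<^sup>1\<close> contraction. Let \<open>w = \<rho>\<^sub>2 - \<rho>\<^sub>1\<close> and
  \<open>\<Phi> = \<phi>\<^sub>2 - \<phi>\<^sub>1\<close>. Where \<open>w\<close> vanishes the two densities agree, so
  strict monotonicity of the dissipation in the gradient alone shows that \<open>\<Phi> \<le> 0\<close> where
  \<open>w\<close> becomes positive and \<open>\<Phi> \<ge> 0\<close> where it stops being positive. Hence the mass of
  the positive part of \<open>w\<close> can grow only through the vertices. At a vertex with
  \<open>r\<^sub>2 > r\<^sub>1\<close> the excess is positive on all incident edges, so flow balance turns the boundary
  terms into \<open>q\<^sub>2 - q\<^sub>1 \<le> 0\<close>; at the other vertices there is no contribution. The total
  positive mass starts at zero and therefore stays zero.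
\<close>

subsection \<open>The flux through the set where a function is positive\<close>


text \<open>Locates the left end of the component of the set where \<open>g\<close> is positive that
  contains \<open>b\<close>. The zeros of \<open>g\<close> form a nonempty compact set, so there is
  a largest one, and by the intermediate value theorem a non-positive value after it would force a
  later zero.\<close>

lemma last_zero_before_positive:
  fixes g :: "real \<Rightarrow> real"
  assumes "continuous_on {x..b} g" "x \<le> b" "g x \<le> 0" "0 < g b"
  obtains a where "x \<le> a" "a < b" "g a = 0" "\<And>y. a < y \<Longrightarrow> y \<le> b \<Longrightarrow> 0 < g y"
proof -
  let ?Z = "{y \<in> {x..b}. g y = 0}"
  have zero: "\<exists>z\<ge>y. z \<le> b \<and> g z = 0" if "x \<le> y" "y \<le> b" "g y \<le> 0" for y
    using IVT'[of g y 0 b] that assms continuous_on_subset[OF assms(1), of "{y..b}"] by auto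
  have "closed ?Z"
    using continuous_closed_preimage_constant[OF assms(1), of 0] by simp
  then have "compact ?Z"
    by (metis (no_types, lifting) bounded_closed_interval bounded_subset compact_eq_bounded_closed
        mem_Collect_eq subsetI)
  moreover have "?Z \<noteq> {}"
    using zero[of x] assms by auto
  ultimately obtain a where a: "a \<in> ?Z" "\<And>y. y \<in> ?Z \<Longrightarrow> y \<le> a"
    using compact_attains_sup[of ?Z] by auto
  show thesis
  proof
    show "x \<le> a" "g a = 0" using a by auto
    show "a < b" using a assms by (cases "a = b") auto
    show "0 < g y" if y: "a < y" "y \<le> b" for y
    proof (rule ccontr)
      assume "\<not> 0 < g y"
      then obtain z where "z \<ge> y" "z \<le> b" "g z = 0"
        using zero[of y] y a by auto
      with a(2)[of z] a(1) y show False by auto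
    qed
  qed
qed

lemma first_zero_after_positive:
  fixes g :: "real \<Rightarrow> real"
  assumes "continuous_on {x..b} g" "x \<le> b" "0 < g x" "g b \<le> 0"
  obtains a where "x < a" "a \<le> b" "g a = 0" "\<And>y. x \<le> y \<Longrightarrow> y < a \<Longrightarrow> 0 < g y"
proof -
  have "continuous_on {-b..-x} (\<lambda>y. g (- y))"
    by (rule continuous_on_compose2[OF assms(1)]) (auto intro!: continuous_intros)
  then obtain a where a: "- b \<le> a" "a < - x" "g (- a) = 0"
      "\<And>y. a < y \<Longrightarrow> y \<le> - x \<Longrightarrow> 0 < g (- y)"
    using last_zero_before_positive[of "-b" "-x" "\<lambda>y. g (- y)"] assms by auto
  show thesis
  proof
    show "x < - a" "- a \<le> b" "g (- a) = 0" using a by auto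
    show "0 < g y" if "x \<le> y" "y < - a" for y
      using a(4)[of "-y"] that by auto
  qed
qed

text \<open>A negative derivative would make \<open>g\<close> negative just to the right of
  \<open>a\<close>. With its mirror image below, this supplies the sign of the slope at the two ends
  of a component, also when the end is a boundary point and the derivative is one-sided.\<close>

lemma derivative_nonneg_at_zero_before_positive:
  fixes g :: "real \<Rightarrow> real"
  assumes "(g has_real_derivative D) (at a within {x..b})" "x \<le> a" "a < b" "g a = 0"
    "\<And>y. a < y \<Longrightarrow> y \<le> b \<Longrightarrow> 0 < g y"
  shows "0 \<le> D"
proof (rule ccontr)
  assume "\<not> 0 \<le> D"
  then obtain d where d: "d > 0" "\<And>h. 0 < h \<Longrightarrow> a + h \<in> {x..b} \<Longrightarrow> h < d \<Longrightarrow> g (a + h) < g a"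
    using has_real_derivative_neg_dec_right[OF assms(1)] by auto
  define h where "h = min (d / 2) (b - a)"
  have "0 < h" "h < d" "h \<le> b - a" using d(1) assms by (auto simp: h_def min_def)
  with d(2)[of h] assms(2-4) assms(5)[of "a + h"] show False by auto
qed

lemma derivative_nonpos_at_zero_after_positive:
  fixes g :: "real \<Rightarrow> real"
  assumes "(g has_real_derivative D) (at a within {x..b})" "x < a" "a \<le> b" "g a = 0"
    "\<And>y. x \<le> y \<Longrightarrow> y < a \<Longrightarrow> 0 < g y"
  shows "D \<le> 0"
proof (rule ccontr)
  assume "\<not> D \<le> 0"
  then obtain d where d: "d > 0" "\<And>h. 0 < h \<Longrightarrow> a - h \<in> {x..b} \<Longrightarrow> h < d \<Longrightarrow> g (a - h) < g a"
    using has_real_derivative_pos_inc_left[OF assms(1)] by auto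
  define h where "h = min (d / 2) (a - x)"
  have "0 < h" "h < d" "h \<le> a - x" using d(1) assms by (auto simp: h_def min_def)
  with d(2)[of h] assms(2-4) assms(5)[of "a - h"] show False by auto
qed

lemma integrable_on_where_positive:
  fixes g h :: "real \<Rightarrow> real"
  assumes "continuous_on {a..b} g" "continuous_on {a..b} h"
  shows "(\<lambda>y. if 0 < g y then h y else 0) integrable_on {a..b}"
proof -
  have "openin (top_of_set {a..b}) ({a..b} \<inter> g -` {0<..})"
    using continuous_openin_preimage_gen[OF assms(1), of "{0<..}"] by simp
  then obtain T where T: "open T" "{a..b} \<inter> g -` {0<..} = {a..b} \<inter> T"
    by (auto simp: openin_open)
  have meas: "{a..b} \<inter> g -` {0<..} \<in> sets borel"
    unfolding T(2) using T(1) by auto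
  have "set_integrable lborel {a..b} h"
    using borel_integrable_compact[of "{a..b}" h] assms(2) by (simp add: set_integrable_def)
  then have "set_integrable lborel ({a..b} \<inter> g -` {0<..}) h"
    by (rule set_integrable_subset) (use meas in auto)
  then have "h integrable_on ({a..b} \<inter> g -` {0<..})"
    by (rule set_borel_integral_eq_integral)
  then have "(\<lambda>y. if y \<in> {a..b} \<inter> g -` {0<..} then h y else 0) integrable_on {a..b}"
    by (simp only: integrable_restrict_Int)  (simp add: Int_commute Int_assoc)
  then show ?thesis
    by (rule integrable_eq) auto
qed

text \<open>
  The set where \<open>g\<close> is positive may have infinitely many components. The dichotomy on
  \<open>h'\<close> is what continuity of \<open>h'\<close> gives near a point: if \<open>h\<close> is strictly
  decreasing, no component fits inside the interval, because \<open>h\<close> would have to rise from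
  a non-positive to a non-negative value across it.
\<close>

lemma flux_integral_from_nonpositive_point:
  fixes g g' h h' :: "real \<Rightarrow> real"
  assumes g: "\<And>y. y \<in> {x..b} \<Longrightarrow> (g has_real_derivative g' y) (at y within {x..b})"
    and h: "\<And>y. y \<in> {x..b} \<Longrightarrow> (h has_real_derivative h' y) (at y within {x..b})"
    and h': "continuous_on {x..b} h'"
    and up: "\<And>y. y \<in> {x..b} \<Longrightarrow> g y = 0 \<Longrightarrow> 0 \<le> g' y \<Longrightarrow> h y \<le> 0"
    and down: "\<And>y. y \<in> {x..b} \<Longrightarrow> g y = 0 \<Longrightarrow> g' y \<le> 0 \<Longrightarrow> 0 \<le> h y"
    and "x \<le> b" "g x \<le> 0" "0 < e"
    and slope: "(\<forall>y\<in>{x..b}. - e \<le> h' y) \<or> (\<forall>y\<in>{x..b}. h' y < 0)"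
  shows "(if 0 < g b then h b else 0) \<le>
    integral {x..b} (\<lambda>y. if 0 < g y then h' y else 0) + e * (b - x)"
proof -
  let ?k = "\<lambda>y. if 0 < g y then h' y else 0"
  have cg: "continuous_on {x..b} g"
    using g DERIV_continuous_on by blast
  have sub: "(f has_real_derivative f' y) (at y within {u..v})"
    if "\<And>y. y \<in> {x..b} \<Longrightarrow> (f has_real_derivative f' y) (at y within {x..b})" "x \<le> u" "v \<le> b" "y \<in> {u..v}"
    for f f' :: "real \<Rightarrow> real" and u v y
    using that(1)[of y] that(2-4) by (auto intro: DERIV_subset)
  have int: "?k integrable_on {u..v}" if "x \<le> u" "v \<le> b" for u v
    by (rule integrable_on_where_positive; rule continuous_on_subset[of "{x..b}"])
      (use that cg h' in auto)
  \<comment> \<open>At the left end of a component \<open>g\<close> leaves zero upwards, so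
    \<open>g' a\<close> is non-negative and \<open>up\<close> applies. \<open>right_end\<close> is
    the symmetric use of \<open>down\<close>.\<close>
  have left_end: "h a \<le> 0"
    if "x \<le> a" "a < p" "p \<le> b" "g a = 0" "\<And>y. a < y \<Longrightarrow> y \<le> p \<Longrightarrow> 0 < g y" for a p
  proof (rule up)
    show "0 \<le> g' a"
      by (rule derivative_nonneg_at_zero_before_positive[of g _ a x p])
        (use that sub[OF g, of x p a] in auto)
  qed (use that in auto)
  have right_end: "0 \<le> h a"
    if "x \<le> p" "p < a" "a \<le> b" "g a = 0" "\<And>y. p \<le> y \<Longrightarrow> y < a \<Longrightarrow> 0 < g y" for a p
  proof (rule down)
    show "g' a \<le> 0"
      by (rule derivative_nonpos_at_zero_after_positive[of g _ a p b])
        (use that sub[OF g, of p b a] in auto)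
  qed (use that in auto)
  have no_interval: "g p \<le> 0"
    if dec: "\<forall>y\<in>{x..b}. h' y < 0" and pc: "x \<le> p" "p \<le> c" "c \<le> b" "g c \<le> 0" for p c
  proof (rule ccontr)
    assume "\<not> g p \<le> 0"
    then have p: "0 < g p" by simp
    obtain a where a: "x \<le> a" "a < p" "g a = 0" "\<And>y. a < y \<Longrightarrow> y \<le> p \<Longrightarrow> 0 < g y"
      using last_zero_before_positive[of x p g] p pc assms(7) continuous_on_subset[OF cg, of "{x..p}"]
      by auto
    obtain d where d: "p < d" "d \<le> c" "g d = 0" "\<And>y. p \<le> y \<Longrightarrow> y < d \<Longrightarrow> 0 < g y"
      using first_zero_after_positive[of p c g] p pc continuous_on_subset[OF cg, of "{p..c}"]
      by auto
    have "h a \<le> 0" using left_end[of a p] a pc by auto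
    moreover have "0 \<le> h d" using right_end[of p d] d pc by auto
    moreover have "h d < h a"
    proof (rule DERIV_neg_imp_decreasing_open[where f = h])
      show "a < d" using a d by simp
      fix y assume y: "a < y" "y < d"
      then have "y \<in> {x..b}" "y \<in> interior {x..b}" using a d pc by auto
      then show "\<exists>z. (h has_real_derivative z) (at y) \<and> z < 0"
        using h[of y] dec at_within_interior[of y "{x..b}"] by auto
    next
      show "continuous_on {a..d} h"
        using a d pc sub[OF h, of a d] by (intro DERIV_continuous_on) auto
    qed
    ultimately show False by linarith
  qed
  \<comment> \<open>Under the first alternative for the slope the integrand is at least
    \<open>- e\<close> everywhere, being 0 where \<open>g\<close> is not positive. Under the second,
    \<open>no_interval\<close> makes it vanish identically on \<open>{x..c}\<close>.\<close>
  have upto: "0 \<le> integral {x..c} ?k + e * (c - x)" if "x \<le> c" "c \<le> b" "g c \<le> 0" for c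
    using slope
  proof
    assume "\<forall>y\<in>{x..b}. - e \<le> h' y"
    then have "integral {x..c} (\<lambda>y. - e) \<le> integral {x..c} ?k"
      using that \<open>0 < e\<close> by (intro integral_le int) auto
    then show ?thesis using that by (simp add: algebra_simps)
  next
    assume "\<forall>y\<in>{x..b}. h' y < 0"
    then have "integral {x..c} ?k = integral {x..c} (\<lambda>y. 0)"
      using no_interval[of _ c] that by (intro integral_cong) force
    then show ?thesis using that \<open>0 < e\<close> by simp
  qed
  show ?thesis
  proof (cases "0 < g b")
    case False
    then show ?thesis using upto[of b] assms by auto
  next
    case True
    \<comment> \<open>Here \<open>b\<close> lies in a component that starts at \<open>a\<close>. On
      it the integral is exactly \<open>h b - h a\<close> with \<open>h a\<close> non-positive, and
      \<open>upto\<close> handles the part before \<open>a\<close>.\<close>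
    then obtain a where a: "x \<le> a" "a < b" "g a = 0" "\<And>y. a < y \<Longrightarrow> y \<le> b \<Longrightarrow> 0 < g y"
      using last_zero_before_positive[of x b g] cg assms by auto
    have "(h' has_integral (h b - h a)) {a..b}"
      using a sub[OF h, of a b]
      by (intro fundamental_theorem_of_calculus)
        (auto simp: has_real_derivative_iff_has_vector_derivative)
    then have "(?k has_integral (h b - h a)) {a..b}"
      by (rule has_integral_spike_finite[of "{a}", rotated 2]) (use a in auto)
    then have "integral {a..b} ?k = h b - h a" by (rule integral_unique)
    moreover have "integral {x..b} ?k = integral {x..a} ?k + integral {a..b} ?k"
      using a int[of x b] by (intro Henstock_Kurzweil_Integration.integral_combine[symmetric]) auto
    moreover have "h a \<le> 0" using left_end[of a b] a by auto
    moreover have "e * (a - x) \<le> e * (b - x)" using a \<open>0 < e\<close> by auto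
    ultimately show ?thesis using upto[of a] a True by auto
  qed
qed

text \<open>Follows by reflecting \<open>y\<close> to \<open>- y\<close> and replacing
  \<open>h\<close> by its reflected negative. The two sign changes cancel in \<open>h'\<close>,
  while the slope of \<open>g\<close> changes sign, so that \<open>up\<close> and
  \<open>down\<close> exchange roles.\<close>

lemma flux_integral_to_nonpositive_point:
  fixes g g' h h' :: "real \<Rightarrow> real"
  assumes g: "\<And>y. y \<in> {a..x} \<Longrightarrow> (g has_real_derivative g' y) (at y within {a..x})"
    and h: "\<And>y. y \<in> {a..x} \<Longrightarrow> (h has_real_derivative h' y) (at y within {a..x})"
    and h': "continuous_on {a..x} h'"
    and up: "\<And>y. y \<in> {a..x} \<Longrightarrow> g y = 0 \<Longrightarrow> 0 \<le> g' y \<Longrightarrow> h y \<le> 0"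
    and down: "\<And>y. y \<in> {a..x} \<Longrightarrow> g y = 0 \<Longrightarrow> g' y \<le> 0 \<Longrightarrow> 0 \<le> h y"
    and "a \<le> x" "g x \<le> 0" "0 < e"
    and slope: "(\<forall>y\<in>{a..x}. - e \<le> h' y) \<or> (\<forall>y\<in>{a..x}. h' y < 0)"
  shows "- (if 0 < g a then h a else 0) \<le>
    integral {a..x} (\<lambda>y. if 0 < g y then h' y else 0) + e * (x - a)"
proof -
  have refl: "((\<lambda>y. f (- y)) has_real_derivative - f' (- y)) (at y within {-x..-a})"
    if "\<And>y. y \<in> {a..x} \<Longrightarrow> (f has_real_derivative f' y) (at y within {a..x})" "y \<in> {-x..-a}"
    for f f' :: "real \<Rightarrow> real" and y
  proof -
    have "(f has_real_derivative f' (- y)) (at (- y) within uminus ` {-x..-a})"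
      using that(1)[of "- y"] that(2) by (auto)
    then have "((f \<circ> uminus) has_real_derivative f' (- y) * (- 1)) (at y within {-x..-a})"
      by (rule DERIV_image_chain) (auto intro!: derivative_eq_intros)
    then show ?thesis by (simp add: o_def)
  qed
  have "(if 0 < g (- (- a)) then - h (- (- a)) else 0) \<le>
    integral {-x..-a} (\<lambda>y. if 0 < g (- y) then h' (- y) else 0) + e * (- a - - x)"
  proof (rule flux_integral_from_nonpositive_point[where g' = "\<lambda>y. - g' (- y)"])
    show "((\<lambda>y. g (- y)) has_real_derivative - g' (- y)) (at y within {-x..-a})" if "y \<in> {-x..-a}" for y
      using refl[OF g] that by blast
    show "((\<lambda>y. - h (- y)) has_real_derivative h' (- y)) (at y within {-x..-a})" if "y \<in> {-x..-a}" for y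
      using DERIV_minus[OF refl[OF h that]] by simp
    show "continuous_on {-x..-a} (\<lambda>y. h' (- y))"
      by (rule continuous_on_compose2[OF h']) (auto intro!: continuous_intros)
    show "(\<forall>y\<in>{-x..-a}. - e \<le> h' (- y)) \<or> (\<forall>y\<in>{-x..-a}. h' (- y) < 0)"
      using slope by auto
  qed (use assms up down in auto)
  moreover have "integral {-x..-a} (\<lambda>y. if 0 < g (- y) then h' (- y) else 0) =
      integral {a..x} (\<lambda>y. if 0 < g y then h' y else 0)"
    by (rule Henstock_Kurzweil_Integration.integral_reflect_real)
  ultimately show ?thesis by auto
qed

text \<open>Heuristically, a component with both ends inside the interval contributes the
  non-negative difference of \<open>h\<close> at its ends, so only components reaching 0 or
  \<open>L\<close> leave boundary terms. Instead of summing over possibly infinitely many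
  components, the estimate is proved locally with an error proportional to the length of the
  interval; such estimates add up, and bisection makes them global.\<close>

lemma boundary_flux_le_integral_where_positive:
  fixes g g' h h' :: "real \<Rightarrow> real"
  assumes g: "\<And>y. y \<in> {0..L} \<Longrightarrow> (g has_real_derivative g' y) (at y within {0..L})"
    and h: "\<And>y. y \<in> {0..L} \<Longrightarrow> (h has_real_derivative h' y) (at y within {0..L})"
    and h': "continuous_on {0..L} h'"
    and up: "\<And>y. y \<in> {0..L} \<Longrightarrow> g y = 0 \<Longrightarrow> 0 \<le> g' y \<Longrightarrow> h y \<le> 0"
    and down: "\<And>y. y \<in> {0..L} \<Longrightarrow> g y = 0 \<Longrightarrow> g' y \<le> 0 \<Longrightarrow> 0 \<le> h y"
    and "0 \<le> L"
  shows "(if 0 < g L then h L else 0) - (if 0 < g 0 then h 0 else 0) \<le>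
    integral {0..L} (\<lambda>y. if 0 < g y then h' y else 0)"
proof (rule field_le_epsilon)
  fix e0 :: real assume "0 < e0"
  \<comment> \<open>Error per unit length; the \<open>+ 1\<close> keeps the denominator positive
    when \<open>L = 0\<close>.\<close>
  define e where "e = e0 / (L + 1)"
  have e: "0 < e" "e * L \<le> e0" using \<open>0 < e0\<close> \<open>0 \<le> L\<close> by (auto simp: e_def field_simps)
  let ?k = "\<lambda>y. if 0 < g y then h' y else 0"
  let ?B = "\<lambda>y. if 0 < g y then h y else 0"
  let ?P = "\<lambda>a b. 0 \<le> a \<longrightarrow> b \<le> L \<longrightarrow> ?B b - ?B a \<le> integral {a..b} ?k + e * (b - a)"
  have cg: "continuous_on {0..L} g"
    using g DERIV_continuous_on by blast
  have int: "?k integrable_on {u..v}" if "0 \<le> u" "v \<le> L" for u v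
    by (rule integrable_on_where_positive; rule continuous_on_subset[of "{0..L}"])
      (use that cg h' in auto)
  have sub: "(f has_real_derivative f' y) (at y within {u..v})"
    if "\<And>y. y \<in> {0..L} \<Longrightarrow> (f has_real_derivative f' y) (at y within {0..L})" "0 \<le> u" "v \<le> L" "y \<in> {u..v}"
    for f f' :: "real \<Rightarrow> real" and u v y
    using that(1)[of y] that(2-4) by (auto intro: DERIV_subset)
  have combine: "integral {a..c} ?k = integral {a..b} ?k + integral {b..c} ?k"
    if "0 \<le> a" "a \<le> b" "b \<le> c" "c \<le> L" for a b c
    using that int[of a c] by (intro Henstock_Kurzweil_Integration.integral_combine[symmetric]) auto
  have "?P 0 L"
  proof (rule Bolzano[where P = ?P])
    show "0 \<le> L" by fact
    show "?P a c" if "?P a b" "?P b c" "a \<le> b" "b \<le> c" for a b c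
      using that combine[of a b c] by (auto simp: algebra_simps)
    fix x assume x: "0 \<le> x" "x \<le> L"
    then have xL: "x \<in> {0..L}" by simp
    show "\<exists>d>0. \<forall>a b. a \<le> x \<and> x \<le> b \<and> b - a < d \<longrightarrow> ?P a b"
    proof (cases "0 < g x")
      case True
      obtain d where d: "d > 0" "\<And>y. y \<in> {0..L} \<Longrightarrow> dist y x < d \<Longrightarrow> dist (g y) (g x) < g x"
        using cg True xL unfolding continuous_on_iff by metis
      have "?P a b" if ab: "a \<le> x" "x \<le> b" "b - a < d" for a b
      proof (intro impI)
        assume bd: "0 \<le> a" "b \<le> L"
        have pos: "0 < g y" if "y \<in> {a..b}" for y
        proof -
          have "dist y x < d" using that ab by (auto simp: dist_real_def)
          with d(2)[of y] that bd show ?thesis by (auto simp: dist_real_def)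
        qed
        have "(h' has_integral (h b - h a)) {a..b}"
          using ab bd sub[OF h, of a b]
          by (intro fundamental_theorem_of_calculus)
            (auto simp: has_real_derivative_iff_has_vector_derivative)
        then have "integral {a..b} h' = h b - h a" by (rule integral_unique)
        moreover have "integral {a..b} ?k = integral {a..b} h'"
          using pos by (intro integral_cong) auto
        moreover have "0 \<le> e * (b - a)" using e ab by auto
        ultimately show "?B b - ?B a \<le> integral {a..b} ?k + e * (b - a)"
          using pos[of a] pos[of b] ab by auto
      qed
      with d(1) show ?thesis by blast
    next
      case False
      \<comment> \<open>If \<open>h' x\<close> is negative, it stays negative near \<open>x\<close>;
        otherwise \<open>h'\<close> stays above \<open>- e\<close> near \<open>x\<close>. Both
        follow from continuity.\<close>
      obtain d where d: "d > 0" and slope: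
        "(\<forall>y\<in>{0..L}. dist y x < d \<longrightarrow> - e \<le> h' y) \<or> (\<forall>y\<in>{0..L}. dist y x < d \<longrightarrow> h' y < 0)"
      proof (cases "h' x < 0")
        case True
        then have "0 < - h' x" by simp
        then obtain d where d: "d > 0" "\<And>y. y \<in> {0..L} \<Longrightarrow> dist y x < d \<Longrightarrow> dist (h' y) (h' x) < - h' x"
          using h' xL unfolding continuous_on_iff by metis
        have "\<forall>y\<in>{0..L}. dist y x < d \<longrightarrow> h' y < 0"
          using d(2) by (force simp: dist_real_def)
        with d(1) that show ?thesis by blast
      next
        case False
        obtain d where d: "d > 0" "\<And>y. y \<in> {0..L} \<Longrightarrow> dist y x < d \<Longrightarrow> dist (h' y) (h' x) < e"
          using h' e(1) xL unfolding continuous_on_iff by metis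
        have "\<forall>y\<in>{0..L}. dist y x < d \<longrightarrow> - e \<le> h' y"
          using d(2) False by (force simp: dist_real_def)
        with d(1) that show ?thesis by blast
      qed
      have "?P a b" if ab: "a \<le> x" "x \<le> b" "b - a < d" for a b
      proof (intro impI)
        assume bd: "0 \<le> a" "b \<le> L"
        have near: "y \<in> {0..L} \<and> dist y x < d" if "y \<in> {a..b}" for y
          using that ab bd by (auto simp: dist_real_def)
        have slopes: "(\<forall>y\<in>{a..b}. - e \<le> h' y) \<or> (\<forall>y\<in>{a..b}. h' y < 0)"
          using slope near by blast
        \<comment> \<open>The interval is split at \<open>x\<close>, where \<open>g\<close> is not
          positive, so no boundary term arises at the splitting point.\<close>
        have "?B b \<le> integral {x..b} ?k + e * (b - x)"
          by (rule flux_integral_from_nonpositive_point[where g' = g'])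
            (use ab bd False e slopes sub[OF g, of x b] sub[OF h, of x b] up down
              continuous_on_subset[OF h', of "{x..b}"] in auto)
        moreover have "- ?B a \<le> integral {a..x} ?k + e * (x - a)"
          by (rule flux_integral_to_nonpositive_point[where g' = g'])
            (use ab bd False e slopes sub[OF g, of a x] sub[OF h, of a x] up down
              continuous_on_subset[OF h', of "{a..x}"] in auto)
        ultimately show "?B b - ?B a \<le> integral {a..b} ?k + e * (b - a)"
          using combine[of a x b] ab bd by (simp add: algebra_simps)
      qed
      with d(1) show ?thesis by blast
    qed
  qed
  with e \<open>0 \<le> L\<close> show "?B L - ?B 0 \<le> integral {0..L} ?k + e0"
    by (auto simp: algebra_simps)
qed


subsection \<open>Growth of the mass of the positive part\<close>

lemma C1_on_imp_continuous_on:
  assumes "C1_on g S"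
  shows "continuous_on S g"
proof -
  obtain g' where "\<And>x. x \<in> S \<Longrightarrow> (g has_derivative blinfun_apply (g' x)) (at x within S)"
    using assms unfolding C1_on_def by blast
  then show ?thesis by (rule has_derivative_continuous_on)
qed

lemma C2_on_imp_continuous_on:
  assumes "C2_on g S"
  shows "continuous_on S g"
proof -
  obtain g' where "\<And>x. x \<in> S \<Longrightarrow> (g has_derivative blinfun_apply (g' x)) (at x within S)"
    using assms unfolding C2_on_def by blast
  then show ?thesis by (rule has_derivative_continuous_on)
qed

text \<open>Composing the total derivative with axis-parallel segments gives one-sided partial
  derivatives. Positivity of \<open>T\<close> and \<open>L\<close> makes derivatives within the
  intervals unique, so that the chosen values \<open>partial_t\<close> and \<open>partial_x\<close>
  are these; continuity is inherited from the total derivative.\<close>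

lemma C2_on_partials:
  assumes u: "C2_on (\<lambda>(t, x). u t x) ({0..T} \<times> {0..L})" and "0 < T" "0 < L"
  shows "\<And>t x. t \<in> {0..T} \<Longrightarrow> x \<in> {0..L} \<Longrightarrow>
      ((\<lambda>s. u s x) has_real_derivative partial_t T u t x) (at t within {0..T})"
    and "\<And>t x. t \<in> {0..T} \<Longrightarrow> x \<in> {0..L} \<Longrightarrow>
      ((\<lambda>y. u t y) has_real_derivative partial_x L u t x) (at x within {0..L})"
    and "continuous_on ({0..T} \<times> {0..L}) (\<lambda>(t, x). partial_t T u t x)"
    and "continuous_on ({0..T} \<times> {0..L}) (\<lambda>(t, x). partial_x L u t x)"
    and "continuous_on ({0..T} \<times> {0..L}) (\<lambda>(t, x). u t x)"
proof -
  let ?R = "{0..T} \<times> {0..L}"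
  obtain g' :: "real \<times> real \<Rightarrow> ((real \<times> real) \<Rightarrow>\<^sub>L real)"
    where g': "\<And>p. p \<in> ?R \<Longrightarrow>
        ((\<lambda>(t, x). u t x) has_derivative blinfun_apply (g' p)) (at p within ?R)"
      and "C1_on g' ?R"
    using u unfolding C2_on_def by blast
  then have cg': "continuous_on ?R g'"
    by (simp add: C1_on_imp_continuous_on)
  have chain: "((\<lambda>z. u (fst (\<gamma> z)) (snd (\<gamma> z))) has_real_derivative g' (\<gamma> y) v) (at y within I)"
    if \<gamma>: "(\<gamma> has_derivative (\<lambda>h. h *\<^sub>R v)) (at y within I)" and y: "y \<in> I" "\<gamma> ` I \<subseteq> ?R"
    for \<gamma> :: "real \<Rightarrow> real \<times> real" and v y I
  proof -
    have "((\<lambda>(t, x). u t x) has_derivative blinfun_apply (g' (\<gamma> y))) (at (\<gamma> y) within \<gamma> ` I)"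
      using g'[of "\<gamma> y"] y by (auto intro: has_derivative_subset)
    then have "((\<lambda>(t, x). u t x) \<circ> \<gamma> has_derivative blinfun_apply (g' (\<gamma> y)) \<circ> (\<lambda>h. h *\<^sub>R v)) (at y within I)"
      using \<gamma> by (rule diff_chain_within[rotated])
    moreover have "blinfun_apply (g' (\<gamma> y)) \<circ> (\<lambda>h. h *\<^sub>R v) = (*) (blinfun_apply (g' (\<gamma> y)) v)"
      by (auto simp: fun_eq_iff blinfun.scaleR_right)
    moreover have "(\<lambda>(t, x). u t x) \<circ> \<gamma> = (\<lambda>z. u (fst (\<gamma> z)) (snd (\<gamma> z)))"
      by (simp add: fun_eq_iff case_prod_beta)
    ultimately show ?thesis
      unfolding has_field_derivative_def by (simp only:)
  qed
  have T: "((\<lambda>s. u s x) has_real_derivative g' (t, x) (1, 0)) (at t within {0..T})"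
    if "t \<in> {0..T}" "x \<in> {0..L}" for t x
  proof -
    have "((\<lambda>s. (s, x)) has_derivative (\<lambda>h. h *\<^sub>R (1, 0))) (at t within {0..T})"
      by (auto intro!: derivative_eq_intros)
    moreover have "(\<lambda>s. (s, x)) ` {0..T} \<subseteq> ?R" using that by auto
    ultimately show ?thesis using chain[of "\<lambda>s. (s, x)" "(1, 0)" t "{0..T}"] that by simp
  qed
  have X: "((\<lambda>y. u t y) has_real_derivative g' (t, x) (0, 1)) (at x within {0..L})"
    if "t \<in> {0..T}" "x \<in> {0..L}" for t x
  proof -
    have "((\<lambda>y. (t, y)) has_derivative (\<lambda>h. h *\<^sub>R (0, 1))) (at x within {0..L})"
      by (auto intro!: derivative_eq_intros)
    moreover have "(\<lambda>y. (t, y)) ` {0..L} \<subseteq> ?R" using that by auto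
    ultimately show ?thesis using chain[of "\<lambda>y. (t, y)" "(0, 1)" x "{0..L}"] that by simp
  qed
  have pt: "partial_t T u t x = g' (t, x) (1, 0)" if "t \<in> {0..T}" "x \<in> {0..L}" for t x
    unfolding partial_t_def using T[OF that] that \<open>0 < T\<close> vector_derivative_within_cbox[of 0 T t]
    by (auto simp: has_real_derivative_iff_has_vector_derivative)
  have px: "partial_x L u t x = g' (t, x) (0, 1)" if "t \<in> {0..T}" "x \<in> {0..L}" for t x
    unfolding partial_x_def using X[OF that] that \<open>0 < L\<close> vector_derivative_within_cbox[of 0 L x]
    by (auto simp: has_real_derivative_iff_has_vector_derivative)
  show "((\<lambda>s. u s x) has_real_derivative partial_t T u t x) (at t within {0..T})"
    if "t \<in> {0..T}" "x \<in> {0..L}" for t x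
    using T[OF that] pt[OF that] by simp
  show "((\<lambda>y. u t y) has_real_derivative partial_x L u t x) (at x within {0..L})"
    if "t \<in> {0..T}" "x \<in> {0..L}" for t x
    using X[OF that] px[OF that] by simp
  have "continuous_on ?R (\<lambda>p. g' p (1, 0))"
    using cg' by (intro continuous_intros)
  then show "continuous_on ?R (\<lambda>(t, x). partial_t T u t x)"
    by (rule continuous_on_eq) (auto simp: pt)
  have "continuous_on ?R (\<lambda>p. g' p (0, 1))"
    using cg' by (intro continuous_intros)
  then show "continuous_on ?R (\<lambda>(t, x). partial_x L u t x)"
    by (rule continuous_on_eq) (auto simp: px)
  show "continuous_on ?R (\<lambda>(t, x). u t x)"
    by (rule C2_on_imp_continuous_on[OF u])
qed

lemma continuous_on_time_slice:
  assumes "continuous_on (A \<times> B) (\<lambda>(t, x). u t x)" "t \<in> A"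
  shows "continuous_on B (u t)"
proof -
  have "continuous_on B (\<lambda>x. (t, x))" by (intro continuous_intros)
  from continuous_on_compose2[OF assms(1) this] assms(2) show ?thesis by auto
qed

section \<open>Increments in time of the mass of the positive part\<close>

text \<open>The positivity set is frozen at the later time \<open>t\<close>. On it the mean value
  theorem bounds the increment of \<open>w\<close>, and off it the positive part at time
  \<open>t\<close> is 0, so an upper bound never requires differentiating a maximum or following a
  moving set. The threshold \<open>d\<close> is phrased as an eventuality so that finitely many
  edges can share one.\<close>

lemma positive_mass_increment:
  fixes w wt :: "real \<Rightarrow> real \<Rightarrow> real"
  assumes wt: "\<And>t x. t \<in> {0..T} \<Longrightarrow> x \<in> {0..L} \<Longrightarrow>
      ((\<lambda>s. w s x) has_real_derivative wt t x) (at t within {0..T})"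
    and cw: "continuous_on ({0..T} \<times> {0..L}) (\<lambda>(t, x). w t x)"
    and cwt: "continuous_on ({0..T} \<times> {0..L}) (\<lambda>(t, x). wt t x)"
    and "0 < e" "0 \<le> L"
  shows "\<forall>\<^sub>F d in at_right 0. \<forall>s t. 0 \<le> s \<longrightarrow> s < t \<longrightarrow> t \<le> T \<longrightarrow> t - s < d \<longrightarrow>
    integral {0..L} (\<lambda>x. max 0 (w t x)) \<le> integral {0..L} (\<lambda>x. max 0 (w s x)) +
      (t - s) * (integral {0..L} (\<lambda>x. if 0 < w t x then wt t x else 0) + e * L)"
proof -
  \<comment> \<open>Uniform continuity on the compact rectangle gives one \<open>d0\<close> for all
    positions and times.\<close>
  have "uniformly_continuous_on ({0..T} \<times> {0..L}) (\<lambda>(t, x). wt t x)"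
    by (intro compact_uniformly_continuous cwt compact_Times) auto
  then obtain d0 where d0: "d0 > 0" "\<And>p p'. p \<in> {0..T} \<times> {0..L} \<Longrightarrow> p' \<in> {0..T} \<times> {0..L} \<Longrightarrow>
      dist p' p < d0 \<Longrightarrow> dist (case p' of (t, x) \<Rightarrow> wt t x) (case p of (t, x) \<Rightarrow> wt t x) < e"
    unfolding uniformly_continuous_on_def using \<open>0 < e\<close> by metis
  have near: "wt c x \<le> wt t x + e"
    if "c \<in> {0..T}" "t \<in> {0..T}" "x \<in> {0..L}" "\<bar>c - t\<bar> < d0" for c t x
  proof -
    have "dist (c, x) (t, x) < d0" using that by (simp add: dist_Pair_Pair dist_real_def)
    with d0(2)[of "(t, x)" "(c, x)"] that show ?thesis by (auto simp: dist_real_def)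
  qed
  have step: "integral {0..L} (\<lambda>x. max 0 (w t x)) \<le> integral {0..L} (\<lambda>x. max 0 (w s x)) +
      (t - s) * (integral {0..L} (\<lambda>x. if 0 < w t x then wt t x else 0) + e * L)"
    if st: "0 \<le> s" "s < t" "t \<le> T" "t - s < d0" for s t
  proof -
    let ?k = "\<lambda>x. if 0 < w t x then wt t x else 0"
    have cw_slice: "continuous_on {0..L} (w t')" if "t' \<in> {0..T}" for t'
      using continuous_on_time_slice[OF cw that] .
    have k: "?k integrable_on {0..L}"
    proof (rule integrable_on_where_positive)
      show "continuous_on {0..L} (w t)" "continuous_on {0..L} (wt t)"
        using st continuous_on_time_slice[OF cwt, of t] cw_slice[of t] by auto
    qed
    have pos: "(\<lambda>x. max 0 (w t' x)) integrable_on {0..L}" if "t' \<in> {0..T}" for t'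
      using cw_slice[OF that] by (intro integrable_continuous_real continuous_intros) auto
    have pointwise: "max 0 (w t x) \<le> max 0 (w s x) + ((t - s) * ?k x + (t - s) * e)"
      if x: "x \<in> {0..L}" for x
    proof (cases "0 < w t x")
      case True
      have "((\<lambda>s. w s x) has_derivative (*) (wt c x)) (at c within {s..t})" if "s \<le> c" "c \<le> t" for c
        using wt[of c x] x st that
        by (auto simp: has_field_derivative_def intro: has_derivative_subset)
      then obtain c where c: "c \<in> {s<..<t}" "w t x - w s x = wt c x * (t - s)"
        using mvt_simple[of s t "\<lambda>s. w s x" "\<lambda>c. (*) (wt c x)"] st by auto
      moreover have "wt c x \<le> wt t x + e"
        using c st x by (intro near) auto
      ultimately have "w t x - w s x \<le> (wt t x + e) * (t - s)"
        using st by (auto intro!: mult_right_mono)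
      with True show ?thesis by (simp add: algebra_simps)
    next
      case False
      have "0 \<le> (t - s) * e" using st \<open>0 < e\<close> by simp
      then show ?thesis using False by simp
    qed
    have "((\<lambda>x. max 0 (w s x) + ((t - s) * ?k x + (t - s) * e)) has_integral
        integral {0..L} (\<lambda>x. max 0 (w s x)) + ((t - s) * integral {0..L} ?k + (L - 0) *\<^sub>R ((t - s) * e))) {0..L}"
    proof (intro has_integral_add)
      show "((\<lambda>x. max 0 (w s x)) has_integral integral {0..L} (\<lambda>x. max 0 (w s x))) {0..L}"
        using pos[of s] st by (auto intro: integrable_integral)
      show "((\<lambda>x. (t - s) * ?k x) has_integral (t - s) * integral {0..L} ?k) {0..L}"
        by (rule has_integral_mult_right[OF integrable_integral[OF k]])
      show "((\<lambda>x. (t - s) * e) has_integral (L - 0) *\<^sub>R ((t - s) * e)) {0..L}"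
        using has_integral_const_real[of "(t - s) * e" 0 L] \<open>0 \<le> L\<close> by simp
    qed
    moreover have "((\<lambda>x. max 0 (w t x)) has_integral integral {0..L} (\<lambda>x. max 0 (w t x))) {0..L}"
      using pos[of t] st by (auto intro: integrable_integral)
    ultimately have "integral {0..L} (\<lambda>x. max 0 (w t x)) \<le>
        integral {0..L} (\<lambda>x. max 0 (w s x)) + ((t - s) * integral {0..L} ?k + (L - 0) *\<^sub>R ((t - s) * e))"
      using has_integral_le pointwise by blast
    then show ?thesis
      by (simp add: algebra_simps)
  qed
  show ?thesis
    unfolding eventually_at_right_field using d0(1) step
    by (intro exI[of _ d0]) auto
qed

text \<open>The errors \<open>e * (t - s)\<close> are additive over adjacent intervals, so bisection
  gives a total error of at most \<open>e * T\<close>, which can be made arbitrarily small. No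
  differentiability of \<open>M\<close> enters.\<close>

lemma nonincreasing_if_locally_almost_nonincreasing:
  fixes M :: "real \<Rightarrow> real"
  assumes "0 \<le> T"
    and step: "\<And>e. 0 < e \<Longrightarrow>
      \<exists>d>0. \<forall>s t. 0 \<le> s \<longrightarrow> s < t \<longrightarrow> t \<le> T \<longrightarrow> t - s < d \<longrightarrow> M t \<le> M s + e * (t - s)"
  shows "M T \<le> M 0"
proof (rule field_le_epsilon)
  fix e0 :: real assume "0 < e0"
  define e where "e = e0 / (T + 1)"
  have e: "0 < e" "e * T \<le> e0" using \<open>0 < e0\<close> \<open>0 \<le> T\<close> by (auto simp: e_def field_simps)
  obtain d where d: "d > 0"
    "\<And>s t. 0 \<le> s \<Longrightarrow> s < t \<Longrightarrow> t \<le> T \<Longrightarrow> t - s < d \<Longrightarrow> M t \<le> M s + e * (t - s)"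
    using step[OF e(1)] by blast
  let ?P = "\<lambda>a b. 0 \<le> a \<longrightarrow> b \<le> T \<longrightarrow> M b \<le> M a + e * (b - a)"
  have "?P 0 T"
  proof (rule Bolzano[where P = ?P])
    show "?P a c" if "?P a b" "?P b c" "a \<le> b" "b \<le> c" for a b c
      using that by (auto simp: algebra_simps)
    show "\<exists>d>0. \<forall>a b. a \<le> x \<and> x \<le> b \<and> b - a < d \<longrightarrow> ?P a b" for x
    proof (intro exI[of _ d] conjI allI impI)
      fix a b assume ab: "a \<le> x \<and> x \<le> b \<and> b - a < d" "0 \<le> a" "b \<le> T"
      show "M b \<le> M a + e * (b - a)"
        using d(2)[of a b] ab by (cases "a = b") auto
    qed (use d in auto)
  qed fact
  with e \<open>0 \<le> T\<close> show "M T \<le> M 0 + e0" by auto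
qed

subsection \<open>Edges, vertices and the comparison\<close>

text \<open>Double counting: tail terms are grouped by the first component of the edge and head
  terms by the second. This converts boundary terms of edges into net outflows of vertices.\<close>

lemma sum_edges_by_vertices:
  fixes A B :: "'v \<Rightarrow> 'v \<Rightarrow> real"
  assumes "finite V" "E \<subseteq> V \<times> V"
  shows "(\<Sum>(i, j)\<in>E. (if P i then A i j else 0) - (if P j then B i j else 0)) =
    (\<Sum>i\<in>V. if P i then (\<Sum>k | (i, k) \<in> E. A i k) - (\<Sum>k | (k, i) \<in> E. B k i) else 0)"
proof -
  have finE: "finite E" using assms finite_subset by blast
  have "(\<Sum>(i, j)\<in>E. if P i then A i j else 0) =
      (\<Sum>i\<in>V. \<Sum>(i, j)\<in>{e \<in> E. fst e = i}. if P i then A i j else 0)"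
    using assms finE by (intro sum.group[symmetric]) auto
  also have "\<dots> = (\<Sum>i\<in>V. if P i then (\<Sum>k | (i, k) \<in> E. A i k) else 0)"
  proof (rule sum.cong[OF refl])
    fix i
    have "(\<Sum>(i, j)\<in>{e \<in> E. fst e = i}. if P i then A i j else 0) =
        (\<Sum>k | (i, k) \<in> E. if P i then A i k else 0)"
      by (rule sum.reindex_bij_witness[of _ "\<lambda>k. (i, k)" snd]) auto
    then show "(\<Sum>(i, j)\<in>{e \<in> E. fst e = i}. if P i then A i j else 0) =
        (if P i then (\<Sum>k | (i, k) \<in> E. A i k) else 0)" by simp
  qed
  finally have out: "(\<Sum>(i, j)\<in>E. if P i then A i j else 0) =
      (\<Sum>i\<in>V. if P i then (\<Sum>k | (i, k) \<in> E. A i k) else 0)" .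
  have "(\<Sum>(i, j)\<in>E. if P j then B i j else 0) =
      (\<Sum>j\<in>V. \<Sum>(i, j)\<in>{e \<in> E. snd e = j}. if P j then B i j else 0)"
    using assms finE by (intro sum.group[symmetric]) auto
  also have "\<dots> = (\<Sum>j\<in>V. if P j then (\<Sum>k | (k, j) \<in> E. B k j) else 0)"
  proof (rule sum.cong[OF refl])
    fix j
    have "(\<Sum>(i, j)\<in>{e \<in> E. snd e = j}. if P j then B i j else 0) =
        (\<Sum>k | (k, j) \<in> E. if P j then B k j else 0)"
      by (rule sum.reindex_bij_witness[of _ "\<lambda>k. (k, j)" fst]) auto
    then show "(\<Sum>(i, j)\<in>{e \<in> E. snd e = j}. if P j then B i j else 0) =
        (if P j then (\<Sum>k | (k, j) \<in> E. B k j) else 0)" by simp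
  qed
  finally have inn: "(\<Sum>(i, j)\<in>E. if P j then B i j else 0) =
      (\<Sum>j\<in>V. if P j then (\<Sum>k | (k, j) \<in> E. B k j) else 0)" .
  have "(\<Sum>(i, j)\<in>E. (if P i then A i j else 0) - (if P j then B i j else 0)) =
      (\<Sum>(i, j)\<in>E. if P i then A i j else 0) - (\<Sum>(i, j)\<in>E. if P j then B i j else 0)"
    by (simp add: case_prod_beta sum_subtractf)
  also have "\<dots> = (\<Sum>i\<in>V. (if P i then (\<Sum>k | (i, k) \<in> E. A i k) else 0) -
      (if P i then (\<Sum>k | (k, i) \<in> E. B k i) else 0))"
    unfolding out inn by (rule sum_subtractf[symmetric])
  also have "\<dots> = (\<Sum>i\<in>V. if P i then (\<Sum>k | (i, k) \<in> E. A i k) - (\<Sum>k | (k, i) \<in> E. B k i) else 0)"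
    by (intro sum.cong) auto
  finally show ?thesis .
qed

text \<open>Nodal densities may be 0, whereas the compatibility functions are assumed increasing
  only at positive densities.\<close>

lemma strict_mono_on_atLeast_if_greaterThan:
  fixes f :: "real \<Rightarrow> real"
  assumes mono: "strict_mono_on {0<..} f" and cont: "continuous_on {0..} f"
  shows "strict_mono_on {0..} f"
proof (rule strict_mono_onI)
  fix a b :: real assume ab: "a \<in> {0..}" "b \<in> {0..}" "a < b"
  show "f a < f b"
  proof (cases "a = 0")
    case False
    then show ?thesis using ab strict_mono_onD[OF mono, of a b] by auto
  next
    case True
    \<comment> \<open>The limit at 0 preserves only a weak inequality; the intermediate point
      \<open>b / 2\<close> restores strictness.\<close>
    have "f c \<le> f (b / 2)" if "c \<in> {0<..<b / 2}" for c
      using that strict_mono_onD[OF mono, of c "b / 2"] by auto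
    moreover have "closure {0<..<b / 2} = {0..b / 2}"
      using ab True by (intro closure_greaterThanLessThan) auto
    ultimately have "f 0 \<le> f (b / 2)"
      using continuous_le_on_closure[of "{0<..<b / 2}" f 0 "f (b / 2)"] ab True
        continuous_on_subset[OF cont, of "{0..b / 2}"] by auto
    also have "f (b / 2) < f b" using ab True strict_mono_onD[OF mono, of "b / 2" b] by auto
    finally show ?thesis using True by simp
  qed
qed


section \<open>Consequences of the system on an edge and at a vertex\<close>

lemma ibvp_solution_edge:
  assumes sol: "ibvp_solution N \<rho>0 \<phi>0 q \<rho> \<phi> r" and E: "(i, j) \<in> edges N"
  shows "C2_on (\<lambda>(t, x). \<rho> i j t x) ({0..horizon N} \<times> {0..edge_len N i j})"
    and "C2_on (\<lambda>(t, x). \<phi> i j t x) ({0..horizon N} \<times> {0..edge_len N i j})"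
    and "\<And>t x. t \<in> {0..horizon N} \<Longrightarrow> x \<in> {0..edge_len N i j} \<Longrightarrow> 0 \<le> \<rho> i j t x"
    and "\<And>t x. t \<in> {0..horizon N} \<Longrightarrow> x \<in> {0..edge_len N i j} \<Longrightarrow>
      partial_t (horizon N) (\<rho> i j) t x = - partial_x (edge_len N i j) (\<phi> i j) t x"
    and "\<And>t x. t \<in> {0..horizon N} \<Longrightarrow> x \<in> {0..edge_len N i j} \<Longrightarrow>
      \<phi> i j t x = - dissip N i j t (\<rho> i j t x) (partial_x (edge_len N i j) (\<rho> i j) t x)"
    and "\<And>x. x \<in> {0..edge_len N i j} \<Longrightarrow> \<rho> i j 0 x = \<rho>0 i j x"
    and "\<And>t. t \<in> {0..horizon N} \<Longrightarrow> \<rho> i j t 0 = alpha_lo N i j t (r i t)"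
    and "\<And>t. t \<in> {0..horizon N} \<Longrightarrow> \<rho> i j t (edge_len N i j) = alpha_hi N i j t (r j t)"
proof -
  note sol' = sol[unfolded ibvp_solution_def perturbed_solution_def]
  note edge = bspec[OF conjunct1[OF sol'] E, unfolded case_prod_conv]
  show "C2_on (\<lambda>(t, x). \<rho> i j t x) ({0..horizon N} \<times> {0..edge_len N i j})"
    "C2_on (\<lambda>(t, x). \<phi> i j t x) ({0..horizon N} \<times> {0..edge_len N i j})"
    using edge by simp_all
  show "\<rho> i j 0 x = \<rho>0 i j x" if "x \<in> {0..edge_len N i j}" for x
    using edge that by simp
  show "0 \<le> \<rho> i j t x"
    "partial_t (horizon N) (\<rho> i j) t x = - partial_x (edge_len N i j) (\<phi> i j) t x"
    "\<phi> i j t x = - dissip N i j t (\<rho> i j t x) (partial_x (edge_len N i j) (\<rho> i j) t x)"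
    if "t \<in> {0..horizon N}" "x \<in> {0..edge_len N i j}" for t x
  proof -
    have "\<rho> i j t x \<ge> 0 \<and>
        partial_t (horizon N) (\<rho> i j) t x + partial_x (edge_len N i j) (\<phi> i j) t x - 0 = 0 \<and>
        \<phi> i j t x + dissip N i j t (\<rho> i j t x) (partial_x (edge_len N i j) (\<rho> i j) t x) = 0"
      using edge that by blast
    then show "0 \<le> \<rho> i j t x"
      "partial_t (horizon N) (\<rho> i j) t x = - partial_x (edge_len N i j) (\<phi> i j) t x"
      "\<phi> i j t x = - dissip N i j t (\<rho> i j t x) (partial_x (edge_len N i j) (\<rho> i j) t x)"
      by linarith+
  qed
  have "density_compat_at N t (\<lambda>i. r i t) (\<lambda>i j. \<rho> i j t 0) (\<lambda>i j. \<rho> i j t (edge_len N i j))"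
    if "t \<in> {0..horizon N}" for t
    using conjunct2[OF sol'] that by blast
  then show "\<rho> i j t 0 = alpha_lo N i j t (r i t)"
    "\<rho> i j t (edge_len N i j) = alpha_hi N i j t (r j t)" if "t \<in> {0..horizon N}" for t
    using E that unfolding density_compat_at_def by blast+
qed

lemma ibvp_solution_node:
  assumes sol: "ibvp_solution N \<rho>0 \<phi>0 q \<rho> \<phi> r" and "t \<in> {0..horizon N}" "j \<in> vertices N"
  shows "0 \<le> r j t"
    and "(\<Sum>k | (j, k) \<in> edges N. \<phi> j k t 0) - (\<Sum>i | (i, j) \<in> edges N. \<phi> i j t (edge_len N i j)) = q j t"
proof -
  show "0 \<le> r j t"
    using assms unfolding ibvp_solution_def perturbed_solution_def by blast
  have "flow_balance_at N (\<lambda>j. q j t) (\<lambda>i j. \<phi> i j t 0) (\<lambda>i j. \<phi> i j t (edge_len N i j))"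
    using assms unfolding ibvp_solution_def perturbed_solution_def by blast
  then show "(\<Sum>k | (j, k) \<in> edges N. \<phi> j k t 0) -
      (\<Sum>i | (i, j) \<in> edges N. \<phi> i j t (edge_len N i j)) = q j t"
    using \<open>j \<in> vertices N\<close> unfolding flow_balance_at_def by (force simp: algebra_simps)
qed

text \<open>Lets the order of the two nodal densities at a vertex decide the order of the edge
  densities at every incident edge end.\<close>

lemma alpha_less_iff:
  assumes "flow_network N" "regular_compatibility N" "(i, j) \<in> edges N" "t \<in> {0..horizon N}"
    and "0 \<le> a" "0 \<le> b"
  shows "alpha_lo N i j t a < alpha_lo N i j t b \<longleftrightarrow> a < b"
    and "alpha_hi N i j t a < alpha_hi N i j t b \<longleftrightarrow> a < b"
proof -
  have "strict_mono_on {0..} (f t)" if f: "f \<in> {alpha_lo N i j, alpha_hi N i j}" for f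
  proof (rule strict_mono_on_atLeast_if_greaterThan)
    show "strict_mono_on {0<..} (f t)"
      using assms f unfolding flow_network_def by blast
    have "C2_on (\<lambda>(t, \<rho>). f t \<rho>) ({0..horizon N} \<times> {0..})"
      using assms f unfolding regular_compatibility_def by blast
    then show "continuous_on {0..} (f t)"
      using \<open>t \<in> {0..horizon N}\<close> by (rule continuous_on_time_slice[OF C2_on_imp_continuous_on])
  qed
  then have "strict_mono_on {0..} (alpha_lo N i j t)" "strict_mono_on {0..} (alpha_hi N i j t)"
    by blast+
  with \<open>0 \<le> a\<close> \<open>0 \<le> b\<close>
  show "alpha_lo N i j t a < alpha_lo N i j t b \<longleftrightarrow> a < b"
    and "alpha_hi N i j t a < alpha_hi N i j t b \<longleftrightarrow> a < b"
    by (simp_all add: strict_mono_on_less)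
qed

section \<open>Comparison of two solutions on one network\<close>

context
  fixes N :: "'v flow_network"
    and \<rho>0\<^sub>1 \<rho>0\<^sub>2 \<phi>0\<^sub>1 \<phi>0\<^sub>2 :: "'v edge_data"
    and q\<^sub>1 q\<^sub>2 r\<^sub>1 r\<^sub>2 :: "'v node_field"
    and \<rho>\<^sub>1 \<rho>\<^sub>2 \<phi>\<^sub>1 \<phi>\<^sub>2 :: "'v edge_field"
  assumes network: "flow_network N"
    and dissip: "dissipation_strict_mono N"
    and sol\<^sub>1: "ibvp_solution N \<rho>0\<^sub>1 \<phi>0\<^sub>1 q\<^sub>1 \<rho>\<^sub>1 \<phi>\<^sub>1 r\<^sub>1"
    and sol\<^sub>2: "ibvp_solution N \<rho>0\<^sub>2 \<phi>0\<^sub>2 q\<^sub>2 \<rho>\<^sub>2 \<phi>\<^sub>2 r\<^sub>2"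
begin

abbreviation excess :: "'v edge_field" where
  "excess i j t x \<equiv> \<rho>\<^sub>2 i j t x - \<rho>\<^sub>1 i j t x"

abbreviation excess_flow :: "'v edge_field" where
  "excess_flow i j t x \<equiv> \<phi>\<^sub>2 i j t x - \<phi>\<^sub>1 i j t x"

abbreviation excess_rate :: "'v edge_field" where
  "excess_rate i j t x \<equiv> partial_t (horizon N) (\<rho>\<^sub>2 i j) t x - partial_t (horizon N) (\<rho>\<^sub>1 i j) t x"

text \<open>The L1 norm over the network of the positive part of the excess. It serves as a Lyapunov
  functional: it vanishes exactly when, at time \<open>t\<close>, the second density nowhere exceeds
  the first.\<close>

definition excess_mass :: "real \<Rightarrow> real" where
  "excess_mass t = (\<Sum>(i, j)\<in>edges N. integral {0..edge_len N i j} (\<lambda>x. max 0 (excess i j t x)))"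

lemma continuous_on_excess:
  assumes "(i, j) \<in> edges N" "0 < horizon N"
  shows "continuous_on ({0..horizon N} \<times> {0..edge_len N i j}) (\<lambda>(t, x). excess i j t x)"
    and "continuous_on ({0..horizon N} \<times> {0..edge_len N i j}) (\<lambda>(t, x). excess_rate i j t x)"
proof -
  have L: "0 < edge_len N i j" using network assms unfolding flow_network_def by auto
  note P1 = C2_on_partials[OF ibvp_solution_edge(1)[OF sol\<^sub>1 assms(1)] assms(2) L]
  note P2 = C2_on_partials[OF ibvp_solution_edge(1)[OF sol\<^sub>2 assms(1)] assms(2) L]
  show "continuous_on ({0..horizon N} \<times> {0..edge_len N i j}) (\<lambda>(t, x). excess i j t x)"
    using continuous_on_diff[OF P2(5) P1(5)] by (simp add: case_prod_beta)
  show "continuous_on ({0..horizon N} \<times> {0..edge_len N i j}) (\<lambda>(t, x). excess_rate i j t x)"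
    using continuous_on_diff[OF P2(3) P1(3)] by (simp add: case_prod_beta)
qed

text \<open>Mass balance makes the excess rate the negative space derivative of the excess flow, so
  the flux estimate applies with reversed sign. Its two sign conditions concern points where the
  densities agree; there the flows differ only through the density gradients, and monotonicity of
  the dissipation decides.\<close>

lemma excess_rate_integral_le:
  assumes E: "(i, j) \<in> edges N" and t: "t \<in> {0..horizon N}" and T: "0 < horizon N"
  shows "integral {0..edge_len N i j} (\<lambda>x. if 0 < excess i j t x then excess_rate i j t x else 0) \<le>
    (if 0 < excess i j t 0 then excess_flow i j t 0 else 0) -
    (if 0 < excess i j t (edge_len N i j) then excess_flow i j t (edge_len N i j) else 0)"
proof -
  let ?L = "edge_len N i j"
  have L: "0 < ?L" using network E unfolding flow_network_def by auto
  note e1 = ibvp_solution_edge[OF sol\<^sub>1 E]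
  note e2 = ibvp_solution_edge[OF sol\<^sub>2 E]
  note R1 = C2_on_partials[OF e1(1) T L] and R2 = C2_on_partials[OF e2(1) T L]
  note F1 = C2_on_partials[OF e1(2) T L] and F2 = C2_on_partials[OF e2(2) T L]
  let ?g' = "\<lambda>x. partial_x ?L (\<rho>\<^sub>2 i j) t x - partial_x ?L (\<rho>\<^sub>1 i j) t x"
  let ?h' = "\<lambda>x. partial_x ?L (\<phi>\<^sub>2 i j) t x - partial_x ?L (\<phi>\<^sub>1 i j) t x"
  have mono: "dissip N i j t u v \<le> dissip N i j t u v'" if "0 \<le> u" "v \<le> v'" for u v v'
    using dissip E t that unfolding dissipation_strict_mono_def
    by (auto simp: strict_mono_less_eq)
  have flow: "excess_flow i j t x = dissip N i j t (\<rho>\<^sub>1 i j t x) (partial_x ?L (\<rho>\<^sub>1 i j) t x) -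
      dissip N i j t (\<rho>\<^sub>2 i j t x) (partial_x ?L (\<rho>\<^sub>2 i j) t x)" if "x \<in> {0..?L}" for x
    using e1(5)[OF t that] e2(5)[OF t that] by simp
  have "(if 0 < excess i j t ?L then excess_flow i j t ?L else 0) -
      (if 0 < excess i j t 0 then excess_flow i j t 0 else 0) \<le>
      integral {0..?L} (\<lambda>x. if 0 < excess i j t x then ?h' x else 0)"
  proof (rule boundary_flux_le_integral_where_positive[where g' = ?g'])
    fix x assume x: "x \<in> {0..?L}"
    show "((\<lambda>x. excess i j t x) has_real_derivative ?g' x) (at x within {0..?L})"
      by (intro DERIV_diff R2(2) R1(2) t x)
    show "((\<lambda>x. excess_flow i j t x) has_real_derivative ?h' x) (at x within {0..?L})"
      by (intro DERIV_diff F2(2) F1(2) t x)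
    show "excess_flow i j t x \<le> 0" if "excess i j t x = 0" "0 \<le> ?g' x"
      using that mono[of "\<rho>\<^sub>1 i j t x"] e1(3)[OF t x] unfolding flow[OF x] by simp
    show "0 \<le> excess_flow i j t x" if "excess i j t x = 0" "?g' x \<le> 0"
      using that mono[of "\<rho>\<^sub>1 i j t x"] e1(3)[OF t x] unfolding flow[OF x] by simp
  next
    show "continuous_on {0..?L} ?h'"
      by (intro continuous_on_diff continuous_on_time_slice[OF F2(4) t] continuous_on_time_slice[OF F1(4) t])
  qed (use L in auto)
  moreover have "integral {0..?L} (\<lambda>x. if 0 < excess i j t x then ?h' x else 0) =
      integral {0..?L} (\<lambda>x. - (if 0 < excess i j t x then excess_rate i j t x else 0))"
    using e1(4)[OF t] e2(4)[OF t] by (intro integral_cong) auto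
  ultimately show ?thesis by simp
qed

text \<open>All edge ends at a vertex are active together, namely when the second nodal density is
  larger. Flow balance then sums the boundary terms at such a vertex to the difference of the
  injections, which \<open>node\<close> makes non-positive.\<close>

lemma sum_excess_rate_integral_le:
  assumes regular: "regular_compatibility N"
    and t: "t \<in> {0..horizon N}" and T: "0 < horizon N"
    and node: "\<And>j. j \<in> vertices N \<Longrightarrow> r\<^sub>1 j t < r\<^sub>2 j t \<Longrightarrow> q\<^sub>2 j t \<le> q\<^sub>1 j t"
  shows "(\<Sum>(i, j)\<in>edges N.
    integral {0..edge_len N i j} (\<lambda>x. if 0 < excess i j t x then excess_rate i j t x else 0)) \<le> 0"
proof -
  let ?P = "\<lambda>j. r\<^sub>1 j t < r\<^sub>2 j t"
  let ?hi = "\<lambda>i j. excess_flow i j t (edge_len N i j)"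
  have V: "finite (vertices N)" "edges N \<subseteq> vertices N \<times> vertices N"
    using network unfolding flow_network_def by auto
  have "(\<Sum>(i, j)\<in>edges N.
      integral {0..edge_len N i j} (\<lambda>x. if 0 < excess i j t x then excess_rate i j t x else 0)) \<le>
    (\<Sum>(i, j)\<in>edges N. (if ?P i then excess_flow i j t 0 else 0) - (if ?P j then ?hi i j else 0))"
  proof (rule sum_mono, clarify)
    fix i j assume E: "(i, j) \<in> edges N"
    then have "i \<in> vertices N" "j \<in> vertices N" using V by auto
    note nonneg = ibvp_solution_node(1)[OF sol\<^sub>1 t] ibvp_solution_node(1)[OF sol\<^sub>2 t]
    have "0 < excess i j t 0 \<longleftrightarrow> ?P i"
      using alpha_less_iff(1)[OF network regular E t, of "r\<^sub>1 i t" "r\<^sub>2 i t"] nonneg \<open>i \<in> vertices N\<close>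
        ibvp_solution_edge(7)[OF sol\<^sub>1 E t] ibvp_solution_edge(7)[OF sol\<^sub>2 E t]
      by simp
    moreover have "0 < excess i j t (edge_len N i j) \<longleftrightarrow> ?P j"
      using alpha_less_iff(2)[OF network regular E t, of "r\<^sub>1 j t" "r\<^sub>2 j t"] nonneg \<open>j \<in> vertices N\<close>
        ibvp_solution_edge(8)[OF sol\<^sub>1 E t] ibvp_solution_edge(8)[OF sol\<^sub>2 E t]
      by simp
    ultimately show "integral {0..edge_len N i j}
        (\<lambda>x. if 0 < excess i j t x then excess_rate i j t x else 0) \<le>
      (if ?P i then excess_flow i j t 0 else 0) - (if ?P j then ?hi i j else 0)"
      using excess_rate_integral_le[OF E t T] by simp
  qed
  also have "\<dots> = (\<Sum>j\<in>vertices N. if ?P j then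
      (\<Sum>k | (j, k) \<in> edges N. excess_flow j k t 0) - (\<Sum>k | (k, j) \<in> edges N. ?hi k j) else 0)"
    by (rule sum_edges_by_vertices[OF V])
  also have "\<dots> \<le> 0"
  proof (rule sum_nonpos)
    fix j assume j: "j \<in> vertices N"
    have "(\<Sum>k | (j, k) \<in> edges N. excess_flow j k t 0) - (\<Sum>k | (k, j) \<in> edges N. ?hi k j) =
        q\<^sub>2 j t - q\<^sub>1 j t"
      using ibvp_solution_node(2)[OF sol\<^sub>1 t j] ibvp_solution_node(2)[OF sol\<^sub>2 t j]
      by (simp add: sum_subtractf)
    then show "(if ?P j then (\<Sum>k | (j, k) \<in> edges N. excess_flow j k t 0) -
        (\<Sum>k | (k, j) \<in> edges N. ?hi k j) else 0) \<le> 0"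
      using node[OF j] by simp
  qed
  finally show ?thesis .
qed

lemma excess_mass_le_initial:
  assumes regular: "regular_compatibility N"
    and T: "0 < horizon N" and t\<^sub>1: "0 \<le> t\<^sub>1" "t\<^sub>1 \<le> horizon N"
    and node: "\<And>t j. 0 \<le> t \<Longrightarrow> t \<le> t\<^sub>1 \<Longrightarrow> j \<in> vertices N \<Longrightarrow> r\<^sub>1 j t < r\<^sub>2 j t \<Longrightarrow> q\<^sub>2 j t \<le> q\<^sub>1 j t"
  shows "excess_mass t\<^sub>1 \<le> excess_mass 0"
proof (rule nonincreasing_if_locally_almost_nonincreasing)
  fix e0 :: real assume "0 < e0"
  have finE: "finite (edges N)"
    using network finite_subset unfolding flow_network_def by blast
  have L: "0 < edge_len N i j" if "(i, j) \<in> edges N" for i j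
    using network that unfolding flow_network_def by auto
  \<comment> \<open>The error on each edge is proportional to its length, so the total length
    \<open>C\<close> fixes the choice of \<open>e\<close>.\<close>
  define C where "C = (\<Sum>(i, j)\<in>edges N. edge_len N i j)"
  have C: "0 \<le> C" unfolding C_def using L by (force intro!: sum_nonneg)
  define e where "e = e0 / (C + 1)"
  have e: "0 < e" "e * C \<le> e0" using \<open>0 < e0\<close> C by (auto simp: e_def field_simps)
  let ?m = "\<lambda>i j t. integral {0..edge_len N i j} (\<lambda>x. max 0 (excess i j t x))"
  let ?I = "\<lambda>i j t. integral {0..edge_len N i j}
    (\<lambda>x. if 0 < excess i j t x then excess_rate i j t x else 0)"
  let ?Q = "\<lambda>d i j. \<forall>s t. 0 \<le> s \<longrightarrow> s < t \<longrightarrow> t \<le> horizon N \<longrightarrow> t - s < d \<longrightarrow>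
    ?m i j t \<le> ?m i j s + (t - s) * (?I i j t + e * edge_len N i j)"
  have "\<forall>\<^sub>F d in at_right 0. ?Q d i j" if E: "(i, j) \<in> edges N" for i j
  proof (rule positive_mass_increment)
    fix t x assume "t \<in> {0..horizon N}" "x \<in> {0..edge_len N i j}"
    then show "((\<lambda>s. excess i j s x) has_real_derivative excess_rate i j t x) (at t within {0..horizon N})"
      using C2_on_partials(1)[OF ibvp_solution_edge(1)[OF sol\<^sub>1 E] T L[OF E]]
        C2_on_partials(1)[OF ibvp_solution_edge(1)[OF sol\<^sub>2 E] T L[OF E]]
      by (intro DERIV_diff)
  qed (use continuous_on_excess[OF E T] e L[OF E] in \<open>simp_all add: less_imp_le\<close>)
  then have "\<forall>\<^sub>F d in at_right 0. \<forall>p\<in>edges N. ?Q d (fst p) (snd p)"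
    using finE by (intro eventually_ball_finite) auto
  \<comment> \<open>Extracts a single positive \<open>d\<close> valid for all of the finitely many
    edges.\<close>
  from eventually_happens'[OF trivial_limit_at_right_real
      eventually_conj[OF eventually_at_right_less this]]
  obtain d where "0 < d" and Q: "\<forall>p\<in>edges N. ?Q d (fst p) (snd p)"
    by (elim exE conjE)
  have "excess_mass t \<le> excess_mass s + e0 * (t - s)"
    if st: "0 \<le> s" "s < t" "t \<le> t\<^sub>1" "t - s < d" for s t
  proof -
    have "excess_mass t \<le>
        (\<Sum>(i, j)\<in>edges N. ?m i j s + (t - s) * (?I i j t + e * edge_len N i j))"
      unfolding excess_mass_def
    proof (rule sum_mono, clarify)
      fix i j assume "(i, j) \<in> edges N"
      from bspec[OF Q this] show "?m i j t \<le> ?m i j s + (t - s) * (?I i j t + e * edge_len N i j)"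
        using st t\<^sub>1 unfolding fst_conv snd_conv by simp
    qed
    also have "\<dots> = excess_mass s + (t - s) * ((\<Sum>(i, j)\<in>edges N. ?I i j t) + e * C)"
      unfolding excess_mass_def C_def
      by (simp add: case_prod_beta sum.distrib sum_distrib_left distrib_left)
    \<comment> \<open>The rates are all taken at the same time \<open>t\<close>, so the network
      estimate applies to their sum.\<close>
    also have "\<dots> \<le> excess_mass s + (t - s) * (0 + e0)"
    proof (intro add_left_mono mult_left_mono add_mono)
      show "(\<Sum>(i, j)\<in>edges N. ?I i j t) \<le> 0"
        by (rule sum_excess_rate_integral_le[OF regular _ T]) (use node st t\<^sub>1 in auto)
    qed (use e st in auto)
    finally show ?thesis by (simp add: mult.commute)
  qed
  with \<open>0 < d\<close> show "\<exists>d>0. \<forall>s t. 0 \<le> s \<longrightarrow> s < t \<longrightarrow> t \<le> t\<^sub>1 \<longrightarrow> t - s < d \<longrightarrow>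
      excess_mass t \<le> excess_mass s + e0 * (t - s)"
    by blast
qed fact

lemma excess_nonpos:
  assumes regular: "regular_compatibility N"
    and t\<^sub>1: "0 \<le> t\<^sub>1" "t\<^sub>1 \<le> horizon N"
    and node: "\<And>t j. 0 \<le> t \<Longrightarrow> t \<le> t\<^sub>1 \<Longrightarrow> j \<in> vertices N \<Longrightarrow> r\<^sub>1 j t < r\<^sub>2 j t \<Longrightarrow> q\<^sub>2 j t \<le> q\<^sub>1 j t"
    and init: "\<And>i j x. (i, j) \<in> edges N \<Longrightarrow> x \<in> {0..edge_len N i j} \<Longrightarrow> \<rho>0\<^sub>2 i j x \<le> \<rho>0\<^sub>1 i j x"
    and E: "(i, j) \<in> edges N" and x: "x \<in> {0..edge_len N i j}"
  shows "excess i j t\<^sub>1 x \<le> 0"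
\<comment> \<open>Time 0 is read off from the initial data; it includes a horizon of length 0, where
  derivatives in time carry no information.\<close>
proof (cases "t\<^sub>1 = 0")
  case True
  then show ?thesis
    using init[OF E x] ibvp_solution_edge(6)[OF sol\<^sub>1 E x] ibvp_solution_edge(6)[OF sol\<^sub>2 E x] by simp
next
  case False
  then have T: "0 < horizon N" using t\<^sub>1 by simp
  have finE: "finite (edges N)"
    using network finite_subset unfolding flow_network_def by blast
  let ?m = "\<lambda>t i j. integral {0..edge_len N i j} (\<lambda>x. max 0 (excess i j t x))"
  have slice: "continuous_on {0..edge_len N i j} (\<lambda>x. max 0 (excess i j t\<^sub>1 x))"
    if "(i, j) \<in> edges N" for i j
    using continuous_on_time_slice[OF continuous_on_excess(1)[OF that T], of t\<^sub>1] t\<^sub>1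
    by (intro continuous_on_max continuous_on_const) auto
  have "?m 0 i j = 0" if "(i, j) \<in> edges N" for i j
  proof -
    have "?m 0 i j = integral {0..edge_len N i j} (\<lambda>x. 0)"
      using init[OF that] ibvp_solution_edge(6)[OF sol\<^sub>1 that] ibvp_solution_edge(6)[OF sol\<^sub>2 that]
      by (intro integral_cong) auto
    then show ?thesis by simp
  qed
  then have "excess_mass 0 = 0"
    unfolding excess_mass_def by (force intro!: sum.neutral)
  then have "excess_mass t\<^sub>1 \<le> 0"
    using excess_mass_le_initial[OF regular T t\<^sub>1 node] by simp
  moreover have nonneg: "0 \<le> ?m t\<^sub>1 i j" if "(i, j) \<in> edges N" for i j
    by (intro Henstock_Kurzweil_Integration.integral_nonneg integrable_continuous_real slice that) auto
  \<comment> \<open>Each edge contributes a non-negative mass and their total is at most 0. A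
    continuous non-negative function with zero integral over a nondegenerate interval then vanishes
    everywhere.\<close>
  ultimately have "?m t\<^sub>1 i j = 0"
    using member_le_sum[of "(i, j)" "edges N" "\<lambda>(i, j). ?m t\<^sub>1 i j"] finE E nonneg[OF E]
    unfolding excess_mass_def by force
  moreover have "0 < edge_len N i j" using network E unfolding flow_network_def by auto
  ultimately have "\<forall>x\<in>{0..edge_len N i j}. max 0 (excess i j t\<^sub>1 x) = 0"
    using slice[OF E] by (subst integral_eq_0_iff[symmetric]) auto
  with x show ?thesis by (metis max.cobounded2)
qed

end

theorem theorem2:
  fixes N :: "'v flow_network"
    and \<rho>0\<^sub>1 \<rho>0\<^sub>2 \<phi>0\<^sub>1 \<phi>0\<^sub>2 :: "'v edge_data"
    and q\<^sub>1 q\<^sub>2 r\<^sub>1 r\<^sub>2 :: "'v node_field"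
    and \<rho>\<^sub>1 \<rho>\<^sub>2 \<phi>\<^sub>1 \<phi>\<^sub>2 :: "'v edge_field"
    and S :: "'v set" and t\<^sub>0 :: real
  assumes "flow_network N"
    and "regular_compatibility N"
    and "regular_initial_data N \<rho>0\<^sub>1 \<phi>0\<^sub>1 q\<^sub>1" and "regular_initial_data N \<rho>0\<^sub>2 \<phi>0\<^sub>2 q\<^sub>2"
    and "regular_injections N q\<^sub>1" and "regular_injections N q\<^sub>2"
    and "unique_ibvp_solution N \<rho>0\<^sub>1 \<phi>0\<^sub>1 q\<^sub>1" and "unique_ibvp_solution N \<rho>0\<^sub>2 \<phi>0\<^sub>2 q\<^sub>2"
    and "perturbation_stable N \<rho>0\<^sub>1 \<phi>0\<^sub>1 q\<^sub>1" and "perturbation_stable N \<rho>0\<^sub>2 \<phi>0\<^sub>2 q\<^sub>2"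
    and "dissipation_strict_mono N"
    and "\<forall>(i, j)\<in>edges N. \<forall>x\<in>{0..edge_len N i j}. \<rho>0\<^sub>1 i j x \<ge> \<rho>0\<^sub>2 i j x"
    and "ibvp_solution N \<rho>0\<^sub>1 \<phi>0\<^sub>1 q\<^sub>1 \<rho>\<^sub>1 \<phi>\<^sub>1 r\<^sub>1"
    and "ibvp_solution N \<rho>0\<^sub>2 \<phi>0\<^sub>2 q\<^sub>2 \<rho>\<^sub>2 \<phi>\<^sub>2 r\<^sub>2"
    and "S \<subseteq> vertices N"
    and "t\<^sub>0 \<in> {0..horizon N}"
    and "\<forall>i\<in>S. \<forall>t\<in>{0..t\<^sub>0}. q\<^sub>1 i t \<ge> q\<^sub>2 i t"
    and "\<forall>i\<in>vertices N - S. \<forall>t\<in>{0..t\<^sub>0}. r\<^sub>1 i t \<ge> r\<^sub>2 i t"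
  shows "\<forall>(i, j)\<in>edges N. \<forall>x\<in>{0..edge_len N i j}. \<forall>t\<in>{0..t\<^sub>0}. \<rho>\<^sub>1 i j t x \<ge> \<rho>\<^sub>2 i j t x"
proof clarify
  fix i j x t assume *: "(i, j) \<in> edges N" "x \<in> {0..edge_len N i j}" "t \<in> {0..t\<^sub>0}"
  \<comment> \<open>The two kinds of vertices merge into one condition: a vertex where the second
    nodal density is larger must lie in \<open>S\<close>, and there the injections are
    ordered.\<close>
  have "q\<^sub>2 k s \<le> q\<^sub>1 k s" if "0 \<le> s" "s \<le> t" "k \<in> vertices N" "r\<^sub>1 k s < r\<^sub>2 k s" for k s
  proof -
    have "s \<in> {0..t\<^sub>0}" using that * by auto
    then have "k \<in> S" using assms(18) that by (metis Diff_iff not_le)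
    then show ?thesis using assms(17) \<open>s \<in> {0..t\<^sub>0}\<close> by blast
  qed
  then have "\<rho>\<^sub>2 i j t x - \<rho>\<^sub>1 i j t x \<le> 0"
    using assms(12,16) *
    by (intro excess_nonpos[OF assms(1,11,13,14,2)]) auto
  then show "\<rho>\<^sub>2 i j t x \<le> \<rho>\<^sub>1 i j t x" by simp
qed

end
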